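(* Let $X\in\mathbb{R}^{n\times p}$ be a centered data matrix with columns $X_1,\dots,X_p$, let $a$ be a given number of principal components, and let $k$ be a given upper bound on the cardinality of their common support. The problem $$\max_{W\in\mathbb{R}^{p\times a}}\ \mathrm{tr}(W^TX^TXW)\quad\text{s.t.}\quad \|W\|_0\le k,\ \ W^TW=I_a$$ is equivalent to the problem $$\max_{s\in\{0,1\}^p,\;U\in\mathbb{R}^{n\times a}}\ \sum_{i=1}^p s_i\sum_{j=1}^a (X_i^TU_j)^2\quad\text{s.t.}\quad e^Ts\le k,\ \ U^TU=I_a .$$
   Context: The matrix $X$ has $n$ data points (rows) and $p$ features (columns); centered means that each column of $X$ sums to zero. For a matrix $W$, $\|W\|_0$ denotes the number of nonzero rows of $W$, so the columns of a feasible $W$ are $a$ principal components sharing a support of cardinality at most $k$. $U_j$ is the $j$-th column of $U$, $s_i$ is the $i$-th component of $s$, $e=(1,1,\dots,1)\in\mathbb{R}^p$, and $I_a$ is the $a\times a$ identity matrix.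
   Formalization: The number a of components is assumed to be at most k, p and n, exactly when both problems are feasible; otherwise equivalence fails (e.g. n=1, p=a=k=2) or both maxima are undefined; an optimal s with fewer than a ones may have to be enlarged to support an optimal W. *)

theory Defs
  imports "HOL-Analysis.Analysis"
begin

text \<open>Rows of the data matrix \<open>X\<close> are data points (index type \<open>'n\<close>), columns are features
  (index type \<open>'p\<close>); principal components are indexed by \<open>'a\<close>.\<close>

definition centered :: "real^'p^'n \<Rightarrow> bool" where
  "centered X \<longleftrightarrow> (\<forall>i. (\<Sum>r\<in>UNIV. column i X $ r) = 0)"

definition row_support :: "real^'a^'p \<Rightarrow> 'p set" where
  "row_support W = {i. row i W \<noteq> 0}"

definition zero_norm :: "real^'a^'p \<Rightarrow> nat" where
  "zero_norm W = card (row_support W)"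

definition ones :: "real^'p" where
  "ones = (\<chi> i. 1)"

definition indicator_vec :: "'p set \<Rightarrow> real^'p" where
  "indicator_vec S = (\<chi> i. if i \<in> S then 1 else 0)"

definition spca_feasible :: "nat \<Rightarrow> real^'a^'p \<Rightarrow> bool" where
  "spca_feasible k W \<longleftrightarrow> zero_norm W \<le> k \<and> transpose W ** W = mat 1"

definition spca_objective :: "real^'p^'n \<Rightarrow> real^'a^'p \<Rightarrow> real" where
  "spca_objective X W = trace (transpose W ** transpose X ** X ** W)"

definition geo_feasible :: "nat \<Rightarrow> (real^'p) \<times> (real^'a^'n) \<Rightarrow> bool" where
  "geo_feasible k = (\<lambda>(s, U). (\<forall>i. s $ i \<in> {0, 1}) \<and> ones \<bullet> s \<le> real k
     \<and> transpose U ** U = mat 1)"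

definition geo_objective :: "real^'p^'n \<Rightarrow> (real^'p) \<times> (real^'a^'n) \<Rightarrow> real" where
  "geo_objective X = (\<lambda>(s, U). \<Sum>i\<in>UNIV. s $ i * (\<Sum>j\<in>UNIV. (column i X \<bullet> column j U)\<^sup>2))"

definition spca_optimal :: "real^'p^'n \<Rightarrow> nat \<Rightarrow> real^'a^'p \<Rightarrow> bool" where
  "spca_optimal X k W \<longleftrightarrow> is_arg_max (spca_objective X) (spca_feasible k) W"

definition geo_optimal :: "real^'p^'n \<Rightarrow> nat \<Rightarrow> real^'p \<Rightarrow> real^'a^'n \<Rightarrow> bool" where
  "geo_optimal X k s U \<longleftrightarrow> is_arg_max (geo_objective X) (geo_feasible k) (s, U)"

end

theory Submission
  imports Defs
begin

text \<open>Let \<open>f\<close> be a linear map with adjoint \<open>g\<close>, \<open>v\<close> an orthonormal system of \<open>a\<close> vectors, and \<open>u\<close> an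
  orthonormal system of \<open>a\<close> vectors whose span contains all \<open>f (v j)\<close>. Parseval for \<open>u\<close> followed by
  Bessel for \<open>v\<close> gives
  \<open>\<Sum>j |f (v j)|\<^sup>2 = \<Sum>j,l (f (v j) \<bullet> u l)\<^sup>2 = \<Sum>l,j (v j \<bullet> g (u l))\<^sup>2 \<le> \<Sum>l |g (u l)|\<^sup>2\<close>.
  Applied to \<open>f = X P\<^sub>S\<close> and \<open>g = P\<^sub>S X\<^sup>T\<close>, where \<open>P\<^sub>S\<close> is the coordinate projection onto the support \<open>S\<close>,
  and to the same pair with the roles exchanged, this lets every feasible point of one problem be
  dominated by a feasible point of the other with support in \<open>S\<close>, without singular values. Only the
  passage from \<open>U\<close> to \<open>W\<close> needs \<open>|S| \<ge> a\<close>; smaller supports are enlarged first, which does not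
  decrease the objective.\<close>

section \<open>Orthonormal systems and the adjoint inequality\<close>

definition orthonormal_family :: "('a \<Rightarrow> 'x::real_inner) \<Rightarrow> bool" where
  "orthonormal_family u \<longleftrightarrow> (\<forall>i j. u i \<bullet> u j = (if i = j then 1 else 0))"

lemma orthonormal_familyD:
  "orthonormal_family u \<Longrightarrow> u i \<bullet> u j = (if i = j then 1 else 0)"
  by (simp add: orthonormal_family_def)

lemma bessel_inequality:
  fixes v :: "'a::finite \<Rightarrow> 'x::real_inner"
  assumes "orthonormal_family v"
  shows "(\<Sum>j\<in>UNIV. (x \<bullet> v j)\<^sup>2) \<le> (norm x)\<^sup>2"
proof -
  \<comment> \<open>\<open>q\<close> is the orthogonal projection of \<open>x\<close> onto the span
    of \<open>v\<close>. Both \<open>x \<bullet> q\<close> and \<open>q \<bullet> q\<close> equal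
    the sum of squared coefficients, so the claim is that the residual \<open>x - q\<close> has
    nonnegative square.\<close>
  define q where "q = (\<Sum>j\<in>UNIV. (x \<bullet> v j) *\<^sub>R v j)"
  have xq: "x \<bullet> q = (\<Sum>j\<in>UNIV. (x \<bullet> v j)\<^sup>2)"
    by (simp add: q_def inner_sum_right power2_eq_square)
  have "q \<bullet> v i = x \<bullet> v i" for i
    by (simp add: q_def inner_sum_left orthonormal_familyD[OF assms] if_distrib cong: if_cong)
  then have qq: "q \<bullet> q = (\<Sum>j\<in>UNIV. (x \<bullet> v j)\<^sup>2)"
    by (subst (2) q_def) (simp add: inner_sum_right power2_eq_square)
  have "0 \<le> (x - q) \<bullet> (x - q)" by simp
  also have "\<dots> = x \<bullet> x - (\<Sum>j\<in>UNIV. (x \<bullet> v j)\<^sup>2)"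
    using xq qq by (simp add: inner_diff_left inner_diff_right inner_commute)
  finally show ?thesis by (simp add: power2_norm_eq_inner)
qed

lemma parseval_identity:
  fixes u :: "'a::finite \<Rightarrow> 'x::euclidean_space"
  assumes u: "orthonormal_family u" and x: "x \<in> span (range u)"
  shows "(\<Sum>j\<in>UNIV. (x \<bullet> u j)\<^sup>2) = (norm x)\<^sup>2"
proof -
  have "inj u"
    by (rule injI) (metis orthonormal_familyD[OF u] zero_neq_one)
  have "pairwise orthogonal (range u)"
    using orthonormal_familyD[OF u] by (auto simp: pairwise_def orthogonal_def)
  then have "(\<Sum>b\<in>range u. (x \<bullet> b) *\<^sub>R b) = x"
    using orthonormal_familyD[OF u] x
    by (intro orthonormal_basis_expand) (auto simp: norm_eq_1)
  then have "x = (\<Sum>j\<in>UNIV. (x \<bullet> u j) *\<^sub>R u j)"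
    using \<open>inj u\<close> by (simp add: sum.reindex)
  then have "x \<bullet> x = x \<bullet> (\<Sum>j\<in>UNIV. (x \<bullet> u j) *\<^sub>R u j)"
    by (rule arg_cong)
  then show ?thesis
    unfolding power2_norm_eq_inner by (simp add: inner_sum_right power2_eq_square)
qed

text \<open>The \<open>y j\<close> may be dependent, so orthonormalizing them alone could yield too
  few vectors. A basis \<open>B\<close> of their span has at most a elements and extends to a basis
  \<open>C\<close> of \<open>E\<close> with at least a; some \<open>D\<close> between them has
  exactly a, and an orthonormal basis of \<open>span D\<close> can be indexed by
  \<open>'a\<close>.\<close>

lemma orthonormal_family_spanning:
  fixes y :: "'a::finite \<Rightarrow> 'x::euclidean_space"
  assumes E: "subspace E" "CARD('a) \<le> dim E" and y: "range y \<subseteq> E"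
  obtains u :: "'a \<Rightarrow> 'x"
  where "orthonormal_family u" "range u \<subseteq> E" "range y \<subseteq> span (range u)"
proof -
  obtain B where B: "B \<subseteq> range y" "independent B" "range y \<subseteq> span B" "card B = dim (range y)"
    using basis_exists by blast
  obtain C where C: "B \<subseteq> C" "C \<subseteq> E" "independent C" "E \<subseteq> span C"
    using maximal_independent_subset_extend[of B E] B y by blast
  have "card B \<le> CARD('a)"
    using card_mono[of "range y" B] card_image_le[of UNIV y] B(1) by simp
  moreover have "CARD('a) \<le> card C"
    using E(2) C basis_card_eq_dim by metis
  moreover have "finite C" using C(3) independent_imp_finite by blast
  ultimately obtain D where D: "B \<subseteq> D" "D \<subseteq> C" "card D = CARD('a)"
    using exists_subset_between C(1) by metis
  have "independent D" using C(3) D(2) independent_mono by blast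
  then have dimD: "dim (span D) = CARD('a)"
    using D(3) by (simp add: dim_eq_card_independent)
  obtain Q where Q: "Q \<subseteq> span D" "pairwise orthogonal Q" "\<And>x. x \<in> Q \<Longrightarrow> norm x = 1"
    "independent Q" "card Q = dim (span D)" "span Q = span D"
    using orthonormal_basis_subspace[OF subspace_span] by blast
  have "finite Q" using Q(4) independent_imp_finite by blast
  then obtain u :: "'a \<Rightarrow> 'x" where u: "bij_betw u UNIV Q"
    using finite_same_card_bij[of "UNIV :: 'a set" Q] Q(5) dimD by auto
  have "orthonormal_family u"
    unfolding orthonormal_family_def
  proof (intro allI)
    fix i j
    have "u i \<in> Q" "u j \<in> Q" "u i = u j \<longleftrightarrow> i = j"
      using u by (auto simp: bij_betw_def inj_eq)
    then show "u i \<bullet> u j = (if i = j then 1 else 0)"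
      using Q(2) Q(3)[of "u i"] by (auto simp: pairwise_def orthogonal_def norm_eq_1)
  qed
  moreover have "range u \<subseteq> E"
    using u Q(1) D(2) C(2) span_minimal[OF _ E(1), of D] by (auto simp: bij_betw_def)
  moreover have "range y \<subseteq> span (range u)"
    using u B(3) Q(6) span_mono[OF D(1)] by (auto simp: bij_betw_def)
  ultimately show thesis using that by blast
qed

text \<open>\<open>E\<close> is the space in which the new system has to live: all of R^n when a
  \<open>U\<close> is sought, a coordinate subspace when a \<open>W\<close> is. It must contain the
  values of \<open>f\<close>, because the span of \<open>u\<close> lies in \<open>E\<close> and has
  to contain every \<open>f (v j)\<close>.\<close>

lemma adjoint_family_dominates:
  fixes f :: "'x::euclidean_space \<Rightarrow> 'y::euclidean_space" and v :: "'a::finite \<Rightarrow> 'x"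
  assumes adj: "\<And>x y. f x \<bullet> y = x \<bullet> g y"
    and v: "orthonormal_family v"
    and E: "subspace E" "CARD('a) \<le> dim E" "range f \<subseteq> E"
  obtains u :: "'a \<Rightarrow> 'y" where "orthonormal_family u" "range u \<subseteq> E"
    "(\<Sum>j\<in>UNIV. (norm (f (v j)))\<^sup>2) \<le> (\<Sum>l\<in>UNIV. (norm (g (u l)))\<^sup>2)"
proof -
  have "range (\<lambda>j. f (v j)) \<subseteq> E" using E(3) by auto
  then obtain u :: "'a \<Rightarrow> 'y" where u: "orthonormal_family u" "range u \<subseteq> E"
    "range (\<lambda>j. f (v j)) \<subseteq> span (range u)"
    using orthonormal_family_spanning[OF E(1,2)] by metis
  have "(\<Sum>j\<in>UNIV. (norm (f (v j)))\<^sup>2) = (\<Sum>j\<in>UNIV. \<Sum>l\<in>UNIV. (f (v j) \<bullet> u l)\<^sup>2)"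
    using u(3) by (intro sum.cong refl parseval_identity[OF u(1), symmetric]) auto
  also have "\<dots> = (\<Sum>l\<in>UNIV. \<Sum>j\<in>UNIV. (g (u l) \<bullet> v j)\<^sup>2)"
    by (subst sum.swap) (simp add: adj inner_commute[of "g _"])
  also have "\<dots> \<le> (\<Sum>l\<in>UNIV. (norm (g (u l)))\<^sup>2)"
    by (intro sum_mono bessel_inequality v)
  finally show thesis using that u by blast
qed

section \<open>Coordinate projections and the objectives as sums of squared norms\<close>

definition coordinate_projection :: "'p set \<Rightarrow> real^'p \<Rightarrow> real^'p" where
  "coordinate_projection S x = (\<chi> i. if i \<in> S then x $ i else 0)"

definition coordinate_subspace :: "'p set \<Rightarrow> (real^'p) set" where
  "coordinate_subspace S = {x. \<forall>i. i \<notin> S \<longrightarrow> x $ i = 0}"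

lemma subspace_coordinate_subspace: "subspace (coordinate_subspace S)"
  by (auto simp: coordinate_subspace_def subspace_def)

lemma card_le_dim_coordinate_subspace: "card S \<le> dim (coordinate_subspace S)"
proof -
  let ?B = "(\<lambda>i. axis i (1::real)) ` S"
  have "card ?B = card S"
    by (rule card_image) (simp add: inj_on_def axis_eq_axis)
  moreover have "?B \<subseteq> coordinate_subspace S"
    by (auto simp: coordinate_subspace_def axis_def)
  moreover have "independent ?B"
    by (rule independent_mono[OF independent_Basis]) (auto simp: Basis_vec_def)
  ultimately show ?thesis using independent_card_le_dim by metis
qed

lemma coordinate_projection_in_subspace: "coordinate_projection S x \<in> coordinate_subspace S"
  by (simp add: coordinate_projection_def coordinate_subspace_def)

lemma coordinate_projection_ident:
  "x \<in> coordinate_subspace S \<Longrightarrow> coordinate_projection S x = x"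
  by (auto simp: coordinate_projection_def coordinate_subspace_def vec_eq_iff)

lemma coordinate_projection_adjoint:
  "coordinate_projection S x \<bullet> y = x \<bullet> coordinate_projection S y"
  by (auto simp: coordinate_projection_def inner_vec_def intro!: sum.cong)

text \<open>Turns the condition on rows into one on single columns, so that a support constraint
  becomes membership of the orthonormal vectors in a subspace.\<close>

lemma row_support_subset_iff:
  "row_support W \<subseteq> S \<longleftrightarrow> (\<forall>j. column j W \<in> coordinate_subspace S)"
  by (auto simp: row_support_def coordinate_subspace_def row_def column_def vec_eq_iff subset_eq)

lemma orthonormal_columns_iff:
  "transpose U ** U = mat 1 \<longleftrightarrow> orthonormal_family (\<lambda>j. column j U)"
  for U :: "real^'a^'n"
  by (simp add: matrix_mult_transpose_dot_column orthonormal_family_def vec_eq_iff mat_def)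

lemma column_of_columns: "column j (\<chi> i j. u j $ i) = u j"
  by (simp add: column_def vec_eq_iff)

text \<open>Together with \<open>geo_objective_indicator_eq\<close> this brings both objectives to
  the shape compared by \<open>adjoint_family_dominates\<close>.\<close>

lemma spca_objective_eq:
  "spca_objective X W = (\<Sum>j\<in>UNIV. (norm (X *v column j W))\<^sup>2)"
proof -
  have "spca_objective X W = trace (transpose (X ** W) ** (X ** W))"
    by (simp add: spca_objective_def matrix_transpose_mul matrix_mul_assoc)
  also have "\<dots> = (\<Sum>j\<in>UNIV. (norm (column j (X ** W)))\<^sup>2)"
    by (simp add: matrix_mult_transpose_dot_column trace_def power2_norm_eq_inner)
  also have "\<dots> = (\<Sum>j\<in>UNIV. (norm (X *v column j W))\<^sup>2)"
    by (simp add: column_def matrix_matrix_mult_def matrix_vector_mult_def)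
  finally show ?thesis .
qed

lemma geo_objective_indicator_eq:
  "geo_objective X (indicator_vec S, U)
     = (\<Sum>j\<in>UNIV. (norm (coordinate_projection S (transpose X *v column j U)))\<^sup>2)"
proof -
  have comp: "(transpose X *v y) $ i = column i X \<bullet> y" for y i
    by (simp add: matrix_mult_dot column_def transpose_def)
  have "geo_objective X (indicator_vec S, U)
     = (\<Sum>i\<in>UNIV. \<Sum>j\<in>UNIV. (if i \<in> S then 1 else 0) * (column i X \<bullet> column j U)\<^sup>2)"
    by (simp add: geo_objective_def indicator_vec_def sum_distrib_left)
  also have "\<dots> = (\<Sum>j\<in>UNIV. \<Sum>i\<in>UNIV. (if i \<in> S then 1 else 0) * (column i X \<bullet> column j U)\<^sup>2)"
    by (rule sum.swap)
  also have "\<dots> = (\<Sum>j\<in>UNIV. (norm (coordinate_projection S (transpose X *v column j U)))\<^sup>2)"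
    unfolding power2_norm_eq_inner inner_vec_def[of "coordinate_projection _ _"]
    \<comment> \<open>The deleted rule would turn \<open>transpose X *v y\<close> into
      \<open>y v* X\<close>, where \<open>comp\<close> no longer applies.\<close>
    by (auto simp: coordinate_projection_def comp power2_eq_square simp del: transpose_matrix_vector
        intro!: sum.cong)
  finally show ?thesis .
qed

lemma sum_indicator_vec: "ones \<bullet> indicator_vec S = real (card S)"
  by (simp add: ones_def indicator_vec_def inner_vec_def flip: sum.inter_filter)

lemma geo_feasible_indicator_iff:
  "geo_feasible k (indicator_vec S, U) \<longleftrightarrow> card S \<le> k \<and> transpose U ** U = mat 1"
  by (auto simp: geo_feasible_def sum_indicator_vec) (auto simp: indicator_vec_def)

lemma geo_feasible_indicatorE:
  assumes "geo_feasible k (s, U)"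
  obtains S where "s = indicator_vec S"
proof
  show "s = indicator_vec {i. s $ i = 1}"
    using assms by (auto simp: geo_feasible_def indicator_vec_def vec_eq_iff)
qed

lemma geo_objective_mono:
  "(\<And>i. s $ i \<le> s' $ i) \<Longrightarrow> geo_objective X (s, U) \<le> geo_objective X (s', U)"
  by (auto simp: geo_objective_def intro!: sum_mono mult_right_mono sum_nonneg)

section \<open>Mutual domination of feasible points\<close>

lemma geo_dominates_spca:
  fixes X :: "real^'p^'n" and W :: "real^'a^'p"
  assumes n: "CARD('a) \<le> CARD('n)" and W: "spca_feasible k W"
  obtains U :: "real^'a^'n" where "geo_feasible k (indicator_vec (row_support W), U)"
    "spca_objective X W \<le> geo_objective X (indicator_vec (row_support W), U)"
proof -
  let ?S = "row_support W"
  have adj: "(X *v coordinate_projection ?S x) \<bullet> y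
      = x \<bullet> coordinate_projection ?S (transpose X *v y)" for x y
    by (metis coordinate_projection_adjoint dot_lmul_matrix inner_commute vector_transpose_matrix
        transpose_transpose)
  have "orthonormal_family (\<lambda>j. column j W)"
    using W by (simp add: spca_feasible_def orthonormal_columns_iff)
  then obtain u :: "'a \<Rightarrow> real^'n" where u: "orthonormal_family u"
    "(\<Sum>j\<in>UNIV. (norm (X *v coordinate_projection ?S (column j W)))\<^sup>2)
      \<le> (\<Sum>l\<in>UNIV. (norm (coordinate_projection ?S (transpose X *v u l)))\<^sup>2)"
    \<comment> \<open>The columns of \<open>U\<close> carry no support constraint, so
      \<open>E\<close> is the whole space, of dimension n.\<close>
    using adjoint_family_dominates[where f = "\<lambda>x. X *v coordinate_projection ?S x", OF adj _ subspace_UNIV] n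
    by (auto simp: dim_UNIV)
  define U :: "real^'a^'n" where "U = (\<chi> i j. u j $ i)"
  \<comment> \<open>The projection fixes the columns of \<open>W\<close>, so inserting it leaves the
    objective unchanged.\<close>
  have "column j W \<in> coordinate_subspace ?S" for j
    using row_support_subset_iff by blast
  then have "spca_objective X W \<le> geo_objective X (indicator_vec ?S, U)"
    using u(2) by (simp add: spca_objective_eq geo_objective_indicator_eq U_def column_of_columns
        coordinate_projection_ident)
  moreover have "geo_feasible k (indicator_vec ?S, U)"
    using u(1) W by (simp add: geo_feasible_indicator_iff orthonormal_columns_iff U_def
        column_of_columns spca_feasible_def zero_norm_def)
  ultimately show thesis using that by blast
qed

text \<open>The roles are exchanged: projecting after the transpose of \<open>X\<close> lands in the
  coordinate subspace of \<open>S\<close>, which has room for a orthonormal vectors once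
  \<open>S\<close> has at least a elements.\<close>

lemma spca_dominates_geo:
  fixes X :: "real^'p^'n" and U :: "real^'a^'n"
  assumes S: "CARD('a) \<le> card S" and U: "geo_feasible k (indicator_vec S, U)"
  obtains W :: "real^'a^'p" where "spca_feasible k W" "row_support W \<subseteq> S"
    "geo_objective X (indicator_vec S, U) \<le> spca_objective X W"
proof -
  have adj: "coordinate_projection S (transpose X *v y) \<bullet> x
      = y \<bullet> (X *v coordinate_projection S x)" for x y
    by (metis coordinate_projection_adjoint dot_lmul_matrix inner_commute vector_transpose_matrix
        transpose_transpose)
  have "orthonormal_family (\<lambda>j. column j U)" and k: "card S \<le> k"
    using U by (auto simp: geo_feasible_indicator_iff orthonormal_columns_iff)
  moreover have "CARD('a) \<le> dim (coordinate_subspace S)"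
    using S card_le_dim_coordinate_subspace le_trans by blast
  moreover have "range (\<lambda>y. coordinate_projection S (transpose X *v y)) \<subseteq> coordinate_subspace S"
    using coordinate_projection_in_subspace by blast
  ultimately obtain w :: "'a \<Rightarrow> real^'p" where w: "orthonormal_family w"
    "range w \<subseteq> coordinate_subspace S"
    "(\<Sum>j\<in>UNIV. (norm (coordinate_projection S (transpose X *v column j U)))\<^sup>2)
      \<le> (\<Sum>l\<in>UNIV. (norm (X *v coordinate_projection S (w l)))\<^sup>2)"
    using adjoint_family_dominates[where f = "\<lambda>y. coordinate_projection S (transpose X *v y)",
        OF adj _ subspace_coordinate_subspace] by metis
  define W :: "real^'a^'p" where "W = (\<chi> i j. w j $ i)"
  have w': "w l \<in> coordinate_subspace S" for l using w(2) by auto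
  have supp: "row_support W \<subseteq> S"
    unfolding row_support_subset_iff W_def column_of_columns using w' by blast
  moreover have "geo_objective X (indicator_vec S, U) \<le> spca_objective X W"
    using w(3) by (simp add: spca_objective_eq geo_objective_indicator_eq W_def column_of_columns
        coordinate_projection_ident[OF w'])
  moreover have "spca_feasible k W"
    using w(1) card_mono[OF _ supp] k by (simp add: spca_feasible_def zero_norm_def
        orthonormal_columns_iff W_def column_of_columns)
  ultimately show thesis using that by blast
qed

section \<open>Existence of an optimum by compactness\<close>

lemma compact_orthonormal_columns: "compact {U :: real^'a^'n. transpose U ** U = mat 1}"
proof (rule compact_eq_bounded_closed[THEN iffD2], intro conjI)
  show "bounded {U :: real^'a^'n. transpose U ** U = mat 1}"
  proof (rule boundedI)
    fix U :: "real^'a^'n" assume "U \<in> {U. transpose U ** U = mat 1}"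
    then have U: "orthonormal_family (\<lambda>j. column j U)" by (simp add: orthonormal_columns_iff)
    \<comment> \<open>The inner product of matrices sums over all entries, so orthonormal columns
      give Frobenius norm exactly the square root of a.\<close>
    have "U \<bullet> U = (\<Sum>j\<in>UNIV. column j U \<bullet> column j U)"
      by (subst inner_vec_def, subst inner_vec_def, subst sum.swap)
        (simp add: inner_vec_def column_def)
    also have "\<dots> = real CARD('a)" by (simp add: orthonormal_familyD[OF U])
    finally show "norm U \<le> sqrt CARD('a)" by (simp add: norm_eq_sqrt_inner)
  qed
  have "{U :: real^'a^'n. transpose U ** U = mat 1}
      = (\<Inter>i j. {U. (\<Sum>r\<in>UNIV. U $ r $ i * U $ r $ j) = (if i = j then 1 else 0)})"
    by (auto simp: matrix_mult_transpose_dot_column inner_vec_def column_def vec_eq_iff mat_def)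
  also have "closed \<dots>"
    by (intro closed_INT ballI closed_Collect_eq continuous_intros)
  finally show "closed {U :: real^'a^'n. transpose U ** U = mat 1}" .
qed

lemma compact_geo_feasible: "compact (Collect (geo_feasible k :: (real^'p) \<times> (real^'a^'n) \<Rightarrow> bool))"
proof -
  let ?A = "{s :: real^'p. (\<forall>i. s $ i \<in> {0, 1}) \<and> ones \<bullet> s \<le> real k}"
  \<comment> \<open>Finiteness comes from the finitely many subsets of the index type.\<close>
  have "?A \<subseteq> range indicator_vec"
  proof
    fix s assume "s \<in> ?A"
    then have "s = indicator_vec {i. s $ i = 1}" by (auto simp: indicator_vec_def vec_eq_iff)
    then show "s \<in> range indicator_vec" by blast
  qed
  then have "finite ?A" by (rule finite_subset) simp
  then have "compact (?A \<times> {U :: real^'a^'n. transpose U ** U = mat 1})"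
    by (intro compact_Times finite_imp_compact compact_orthonormal_columns)
  moreover have "Collect (geo_feasible k :: (real^'p) \<times> (real^'a^'n) \<Rightarrow> bool)
      = ?A \<times> {U. transpose U ** U = mat 1}"
    by (auto simp: geo_feasible_def)
  ultimately show ?thesis by simp
qed

lemma geo_optimal_exists:
  fixes X :: "real^'p^'n"
  assumes "CARD('a) \<le> CARD('n)"
  obtains s and U :: "real^'a^'n" where "geo_optimal X k s U"
proof -
  obtain u :: "'a \<Rightarrow> real^'n" where u: "orthonormal_family u"
    \<comment> \<open>The zero family imposes no spanning condition; only a orthonormal vectors in
      R^n are wanted.\<close>
    using orthonormal_family_spanning[of UNIV "\<lambda>_ :: 'a. 0 :: real^'n"] assms by (auto simp: dim_UNIV)
  let ?F = "Collect (geo_feasible k :: (real^'p) \<times> (real^'a^'n) \<Rightarrow> bool)"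
  \<comment> \<open>The empty support is feasible for every \<open>k\<close>.\<close>
  have "(indicator_vec {}, \<chi> i j. u j $ i) \<in> ?F"
    using u by (simp add: geo_feasible_indicator_iff orthonormal_columns_iff column_of_columns)
  then have "?F \<noteq> {}" by blast
  moreover have "continuous_on ?F (geo_objective X)"
    unfolding geo_objective_def case_prod_beta column_def inner_vec_def
    by (simp, intro continuous_intros)
  ultimately have "\<exists>z\<in>?F. \<forall>y\<in>?F. geo_objective X y \<le> geo_objective X z"
    by (rule continuous_attains_sup[OF compact_geo_feasible])
  then obtain z where "z \<in> ?F" "\<forall>y\<in>?F. geo_objective X y \<le> geo_objective X z"
    by blast
  then show thesis
    using that[of "fst z" "snd z"] by (simp add: geo_optimal_def is_arg_max_linorder)
qed

section \<open>Enlarging the support and transferring optimality\<close>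

lemma geo_dominated_enlarging_support:
  fixes X :: "real^'p^'n" and U :: "real^'a^'n"
  assumes k: "CARD('a) \<le> k" and p: "CARD('a) \<le> CARD('p)" and sU: "geo_feasible k (s, U)"
  obtains s' and W :: "real^'a^'p"
  where "\<And>i. s $ i \<le> s' $ i" "real CARD('a) \<le> ones \<bullet> s \<Longrightarrow> s' = s"
    "geo_feasible k (s', U)" "geo_objective X (s, U) \<le> geo_objective X (s', U)"
    "spca_feasible k W" "geo_objective X (s', U) \<le> spca_objective X W"
    "\<And>i. i \<in> row_support W \<Longrightarrow> s' $ i = 1"
proof -
  obtain S where S: "s = indicator_vec S" using geo_feasible_indicatorE[OF sU] .
  have Sk: "card S \<le> k" and U: "transpose U ** U = mat 1"
    using sU by (auto simp: S geo_feasible_indicator_iff)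
  \<comment> \<open>This size is at least a, as the construction of \<open>W\<close> requires, and
    stays within \<open>k\<close> and p because \<open>card S\<close> and a both do. It equals
    \<open>card S\<close> when \<open>s\<close> already has a ones, which forces
    \<open>T = S\<close>.\<close>
  have "\<exists>T. S \<subseteq> T \<and> T \<subseteq> UNIV \<and> card T = max (card S) CARD('a)"
    using p by (intro exists_subset_between) (auto simp: card_mono)
  then obtain T where T: "S \<subseteq> T" "card T = max (card S) CARD('a)" by blast
  have le: "s $ i \<le> indicator_vec T $ i" for i
    using T(1) by (auto simp: S indicator_vec_def)
  have eq: "indicator_vec T = s" if "real CARD('a) \<le> ones \<bullet> s"
  proof -
    have "card S = card T" using that T(2) by (simp add: S sum_indicator_vec)
    then have "S = T" using T(1) by (intro card_subset_eq) auto
    then show ?thesis by (simp add: S)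
  qed
  have feas: "geo_feasible k (indicator_vec T, U)"
    using T(2) Sk k U by (simp add: geo_feasible_indicator_iff)
  obtain W :: "real^'a^'p" where W: "spca_feasible k W" "row_support W \<subseteq> T"
    "geo_objective X (indicator_vec T, U) \<le> spca_objective X W"
    using spca_dominates_geo[OF _ feas] T(2) by (metis max.cobounded2)
  have "indicator_vec T $ i = 1" if "i \<in> row_support W" for i
    using that W(2) by (auto simp: indicator_vec_def)
  then show thesis
    using that[OF le eq feas geo_objective_mono W(1,3)] le by blast
qed

text \<open>The values at \<open>(s, U)\<close>, \<open>(s', U)\<close> and \<open>W\<close>
  increase in this order, while \<open>geo_dominates_spca\<close> and the optimality of
  \<open>(s, U)\<close> bound the last by the first. All three coincide, so \<open>(s', U)\<close>
  and \<open>W\<close> are optimal.\<close>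

lemma geo_optimal_enlarging_support:
  fixes X :: "real^'p^'n" and U :: "real^'a^'n"
  assumes k: "CARD('a) \<le> k" and p: "CARD('a) \<le> CARD('p)" and n: "CARD('a) \<le> CARD('n)"
    and opt: "geo_optimal X k s U"
  obtains s' and W :: "real^'a^'p"
  where "\<And>i. s $ i \<le> s' $ i" "real CARD('a) \<le> ones \<bullet> s \<Longrightarrow> s' = s"
    "geo_optimal X k s' U" "spca_optimal X k W" "\<And>i. i \<in> row_support W \<Longrightarrow> s' $ i = 1"
    "spca_objective X W = geo_objective X (s', U)"
proof -
  have sU: "geo_feasible k (s, U)"
    and max: "\<And>t V. geo_feasible k (t, V :: real^'a^'n) \<Longrightarrow> geo_objective X (t, V) \<le> geo_objective X (s, U)"
    using opt by (auto simp: geo_optimal_def is_arg_max_linorder)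
  obtain s' and W :: "real^'a^'p"
    where le: "\<And>i. s $ i \<le> s' $ i" and eq: "real CARD('a) \<le> ones \<bullet> s \<Longrightarrow> s' = s"
      and s': "geo_feasible k (s', U)" "geo_objective X (s, U) \<le> geo_objective X (s', U)"
      and W: "spca_feasible k W" "geo_objective X (s', U) \<le> spca_objective X W"
      and supp: "\<And>i. i \<in> row_support W \<Longrightarrow> s' $ i = 1"
    using geo_dominated_enlarging_support[OF k p sU] by blast
  have spca_le: "spca_objective X V \<le> geo_objective X (s, U)"
    if V: "spca_feasible k V" for V :: "real^'a^'p"
    using geo_dominates_spca[OF n V] max order_trans by metis
  have "geo_optimal X k s' U"
    using max s' by (fastforce simp: geo_optimal_def is_arg_max_linorder)
  moreover have "spca_optimal X k W"
    using spca_le W s'(2) by (fastforce simp: spca_optimal_def is_arg_max_linorder)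
  moreover have "spca_objective X W = geo_objective X (s', U)"
    using spca_le[OF W(1)] W(2) s'(2) by simp
  ultimately show thesis using that le eq supp by blast
qed

text \<open>An optimal \<open>s\<close> can have fewer than a ones, for instance
  \<open>s = 0\<close> when \<open>X = 0\<close>. No feasible \<open>W\<close> is supported there,
  since a orthonormal columns need at least a nonzero rows; hence the passage to a larger
  \<open>s'\<close>.\<close>

theorem proposition1:
  fixes X :: "real^'p^'n" and k :: nat
  assumes "centered X"
    and "CARD('a::finite) \<le> k"
    and "CARD('a) \<le> CARD('p)"
    and "CARD('a) \<le> CARD('n)"
  shows "(\<exists>(W :: real^'a^'p) s (U :: real^'a^'n).
            spca_optimal X k W \<and> geo_optimal X k s U
            \<and> spca_objective X W = geo_objective X (s, U))
    \<and> (\<forall>W :: real^'a^'p. spca_optimal X k W \<longrightarrow>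
          (\<exists>U :: real^'a^'n. geo_optimal X k (indicator_vec (row_support W)) U))
    \<and> (\<forall>s (U :: real^'a^'n). geo_optimal X k s U \<longrightarrow>
          (\<exists>s' (W :: real^'a^'p). (\<forall>i. s $ i \<le> s' $ i)
             \<and> (real CARD('a) \<le> ones \<bullet> s \<longrightarrow> s' = s)
             \<and> geo_optimal X k s' U \<and> spca_optimal X k W
             \<and> (\<forall>i \<in> row_support W. s' $ i = 1)))"
proof (intro conjI allI impI)
  show "\<exists>(W :: real^'a^'p) s (U :: real^'a^'n). spca_optimal X k W \<and> geo_optimal X k s U
      \<and> spca_objective X W = geo_objective X (s, U)"
  proof -
    obtain s and U :: "real^'a^'n" where opt: "geo_optimal X k s U"
      using geo_optimal_exists[OF assms(4)] .
    show ?thesis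
      by (rule geo_optimal_enlarging_support[OF assms(2-4) opt]) (intro exI conjI)
  qed
next
  fix W :: "real^'a^'p"
  assume "spca_optimal X k W"
  then have W: "spca_feasible k W"
    and max: "\<And>V :: real^'a^'p. spca_feasible k V \<Longrightarrow> spca_objective X V \<le> spca_objective X W"
    by (auto simp: spca_optimal_def is_arg_max_linorder)
  obtain U :: "real^'a^'n" where U: "geo_feasible k (indicator_vec (row_support W), U)"
    "spca_objective X W \<le> geo_objective X (indicator_vec (row_support W), U)"
    using geo_dominates_spca[OF assms(4) W] .
  \<comment> \<open>Any feasible \<open>(t, V)\<close> is dominated by some feasible
    \<open>W'\<close>, hence by the optimal \<open>W\<close>, whose value is at most that of the
    pair formed by its own support and \<open>U\<close>.\<close>
  have "geo_objective X (t, V) \<le> spca_objective X W"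
    if tV: "geo_feasible k (t, V)" for t and V :: "real^'a^'n"
  proof (rule geo_dominated_enlarging_support[OF assms(2,3) tV])
    fix s' and W' :: "real^'a^'p"
    assume "geo_objective X (t, V) \<le> geo_objective X (s', V)"
      and "geo_objective X (s', V) \<le> spca_objective X W'" and "spca_feasible k W'"
    then show ?thesis using max[of W'] by simp
  qed
  then have "geo_optimal X k (indicator_vec (row_support W)) U"
    using U by (fastforce simp: geo_optimal_def is_arg_max_linorder)
  then show "\<exists>U :: real^'a^'n. geo_optimal X k (indicator_vec (row_support W)) U" by blast
next
  fix s and U :: "real^'a^'n"
  assume opt: "geo_optimal X k s U"
  show "\<exists>s' (W :: real^'a^'p). (\<forall>i. s $ i \<le> s' $ i)
      \<and> (real CARD('a) \<le> ones \<bullet> s \<longrightarrow> s' = s)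
      \<and> geo_optimal X k s' U \<and> spca_optimal X k W \<and> (\<forall>i \<in> row_support W. s' $ i = 1)"
    by (rule geo_optimal_enlarging_support[OF assms(2-4) opt])
      (intro exI conjI allI ballI impI)
qed

end
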